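(* Let $(A_i,B_i,C_i)_{i\in I}$ be an STPP construction in an abelian group $H$. Then there is a border tricolored sum-free set in $H$ of cardinality at least \[ \sum_{i\in I}\frac{\lvert A_i\rvert\lvert B_i\rvert\lvert C_i\rvert}{\lvert A_i\rvert+\lvert B_i\rvert+\lvert C_i\rvert}. \]
   Context: $H$ is written additively; for $X,Y\subseteq H$ write $X-Y=\{x-y:x\in X,y\in Y\}$. Subsets $A,B,C\subseteq H$ satisfy the triple product property if for all $a\in A-A$, $b\in B-B$, $c\in C-C$: $a+b+c=0$ iff $a=b=c=0$. An STPP construction in $H$ is a finite collection $(A_i,B_i,C_i)_{i\in I}$ of triples of finite nonempty subsets of $H$ such that each triple satisfies the triple product property, and, with $S_i=A_i-B_i$, $T_j=B_j-C_j$, $U_k=C_k-A_k$, whenever $s+t+u=0$ with $s\in S_i,t\in T_j,u\in U_k$ we have $i=j=k$. A border tricolored sum-free set in $H$ is a set $M\subseteq S\times T\times U$ with $S,T,U\subseteq H$ that is a 3-dimensional perfect matching on $S\times T\times U$ (each coordinate projection of $M$ is a bijection onto $S$, $T$, $U$ respectively), together with functions $\alpha:S\to\mathbb{Z}$, $\beta:T\to\mathbb{Z}$, $\gamma:U\to\mathbb{Z}$, such that $s+t+u=0$ and $\alpha(s)+\beta(t)+\gamma(u)=0$ for all $(s,t,u)\in M$, while for all $(s,t,u)\in(S\times T\times U)\setminus M$ either $s+t+u\neq0$ or $\alpha(s)+\beta(t)+\gamma(u)>0$. Its cardinality is $\lvert M\rvert$. *)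

theory Defs imports Complex_Main begin

text \<open>The ambient abelian group, written additively, is a type of class \<^class>\<open>ab_group_add\<close>.
  The Minkowski difference needs its own name, since \<open>X - Y\<close> on sets is the set-theoretic
  difference.\<close>

definition diff_set :: "'a::ab_group_add set \<Rightarrow> 'a set \<Rightarrow> 'a set" where
  "diff_set X Y = {x - y | x y. x \<in> X \<and> y \<in> Y}"

definition triple_product_property ::
    "'a::ab_group_add set \<Rightarrow> 'a set \<Rightarrow> 'a set \<Rightarrow> bool" where
  "triple_product_property A B C \<longleftrightarrow>
     (\<forall>a \<in> diff_set A A. \<forall>b \<in> diff_set B B. \<forall>c \<in> diff_set C C.
        a + b + c = 0 \<longleftrightarrow> a = 0 \<and> b = 0 \<and> c = 0)"

definition STPP_construction ::
    "'i set \<Rightarrow> ('i \<Rightarrow> 'a::ab_group_add set) \<Rightarrow> ('i \<Rightarrow> 'a set) \<Rightarrow> ('i \<Rightarrow> 'a set) \<Rightarrow> bool" where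
  "STPP_construction I A B C \<longleftrightarrow>
     finite I \<and>
     (\<forall>i\<in>I. finite (A i) \<and> A i \<noteq> {} \<and> finite (B i) \<and> B i \<noteq> {} \<and> finite (C i) \<and> C i \<noteq> {}) \<and>
     (\<forall>i\<in>I. triple_product_property (A i) (B i) (C i)) \<and>
     (\<forall>i\<in>I. \<forall>j\<in>I. \<forall>k\<in>I.
        \<forall>s \<in> diff_set (A i) (B i). \<forall>t \<in> diff_set (B j) (C j). \<forall>u \<in> diff_set (C k) (A k).
          s + t + u = 0 \<longrightarrow> i = j \<and> j = k)"

definition perfect_matching_3d ::
    "'a set \<Rightarrow> 'b set \<Rightarrow> 'c set \<Rightarrow> ('a \<times> 'b \<times> 'c) set \<Rightarrow> bool" where
  "perfect_matching_3d S T U M \<longleftrightarrow>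
     M \<subseteq> S \<times> T \<times> U \<and>
     bij_betw (\<lambda>(s, t, u). s) M S \<and>
     bij_betw (\<lambda>(s, t, u). t) M T \<and>
     bij_betw (\<lambda>(s, t, u). u) M U"

text \<open>The weights \<open>\<alpha>\<close>, \<open>\<beta>\<close>, \<open>\<gamma>\<close> are functions on \<open>S\<close>, \<open>T\<close>, \<open>U\<close>; here they are total
  functions whose values outside these sets play no role.\<close>

definition border_tricolored_sum_free ::
    "'a::ab_group_add set \<Rightarrow> 'a set \<Rightarrow> 'a set \<Rightarrow> ('a \<times> 'a \<times> 'a) set \<Rightarrow>
      ('a \<Rightarrow> int) \<Rightarrow> ('a \<Rightarrow> int) \<Rightarrow> ('a \<Rightarrow> int) \<Rightarrow> bool" where
  "border_tricolored_sum_free S T U M \<alpha> \<beta> \<gamma> \<longleftrightarrow>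
     perfect_matching_3d S T U M \<and>
     (\<forall>(s, t, u) \<in> M. s + t + u = 0 \<and> \<alpha> s + \<beta> t + \<gamma> u = 0) \<and>
     (\<forall>(s, t, u) \<in> (S \<times> T \<times> U) - M. s + t + u \<noteq> 0 \<or> \<alpha> s + \<beta> t + \<gamma> u > 0)"

end

theory Submission imports Defs "HOL-Library.FuncSet" begin

text \<open>Number the elements of each \<open>A i\<close>, \<open>B i\<close>, \<open>C i\<close> by initial segments of the naturals via
  \<open>f\<close>, \<open>g\<close>, \<open>h\<close>. The zero-sum triples of an STPP construction are exactly the triples
  \<open>(a - b, b - c, c - a)\<close> with \<open>a\<close>, \<open>b\<close>, \<open>c\<close> from a common index \<open>i\<close>. Keep those with
  \<open>f a + g b + h c = k i\<close>; any two of \<open>a\<close>, \<open>b\<close>, \<open>c\<close> then determine the third. The square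
  \<open>(f a + g b + h c - k i)\<^sup>2\<close> splits into a sum of functions of the pairs \<open>(a, b)\<close>,
  \<open>(b, c)\<close>, \<open>(c, a)\<close>, which supplies the weights. As \<open>f a + g b + h c\<close> takes fewer than
  \<open>|A i| + |B i| + |C i|\<close> values, the pigeonhole principle gives a \<open>k i\<close> that is attained often
  enough.\<close>

text \<open>The conditions \<open>a + b + c = 0\<close> and \<open>s + t + u = 0\<close> are
  invariant under cyclic shifts because the group is abelian. Facts proved for differences from
  \<open>A i\<close> and \<open>B i\<close> thus transfer to the pairs \<open>B i\<close>,
  \<open>C i\<close> and \<open>C i\<close>, \<open>A i\<close>.\<close>

lemma STPP_rotate:
  fixes A B C :: "'i \<Rightarrow> 'a::ab_group_add set"
  assumes "STPP_construction I A B C"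
  shows "STPP_construction I B C A"
proof -
  have tpp: "triple_product_property Y Z X" if "triple_product_property X Y Z"
    for X Y Z :: "'a set"
  proof -
    have "a + b + c = 0 \<longleftrightarrow> a = 0 \<and> b = 0 \<and> c = 0"
      if "a \<in> diff_set Y Y" "b \<in> diff_set Z Z" "c \<in> diff_set X X" for a b c
    proof -
      have "a + b + c = c + a + b" by (simp add: ac_simps)
      then show ?thesis
        using \<open>triple_product_property X Y Z\<close>[unfolded triple_product_property_def,
            rule_format, OF that(3,1,2)] by metis
    qed
    then show ?thesis unfolding triple_product_property_def by blast
  qed
  have sep: "i = j \<and> j = k"
    if "i \<in> I" "j \<in> I" "k \<in> I" "s \<in> diff_set (B i) (C i)" "t \<in> diff_set (C j) (A j)"
      "u \<in> diff_set (A k) (B k)" "s + t + u = 0" for i j k s t u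
  proof -
    have "u + s + t = 0" using that(7) by (simp add: ac_simps)
    then have "k = i \<and> i = j"
      using assms that(1-6) unfolding STPP_construction_def by blast
    then show ?thesis by simp
  qed
  have "\<forall>i\<in>I. triple_product_property (B i) (C i) (A i)"
    using assms tpp unfolding STPP_construction_def by simp
  moreover have "\<forall>i\<in>I. \<forall>j\<in>I. \<forall>k\<in>I. \<forall>s\<in>diff_set (B i) (C i). \<forall>t\<in>diff_set (C j) (A j).
      \<forall>u\<in>diff_set (A k) (B k). s + t + u = 0 \<longrightarrow> i = j \<and> j = k"
    by (intro ballI impI) (rule sep)
  ultimately show ?thesis
    using assms unfolding STPP_construction_def by simp
qed

text \<open>The separation condition first forces a common index. Regrouping the sum as
  \<open>(a - a') + (b' - b) + (c' - c)\<close> then puts it in reach of the triple product property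
  of that one triple.\<close>

lemma STPP_zero_sum:
  assumes stpp: "STPP_construction I A B C"
    and i: "i \<in> I" "a \<in> A i" "b \<in> B i"
    and j: "j \<in> I" "b' \<in> B j" "c \<in> C j"
    and k: "k \<in> I" "c' \<in> C k" "a' \<in> A k"
    and zero: "(a - b) + (b' - c) + (c' - a') = 0"
  shows "i = j \<and> j = k \<and> a = a' \<and> b = b' \<and> c = c'"
proof -
  have "a - b \<in> diff_set (A i) (B i)" "b' - c \<in> diff_set (B j) (C j)"
    "c' - a' \<in> diff_set (C k) (A k)"
    using i j k unfolding diff_set_def by blast+
  then have eq: "i = j" "j = k"
    using stpp i j k zero unfolding STPP_construction_def by blast+
  have "a - a' \<in> diff_set (A i) (A i)" "b' - b \<in> diff_set (B i) (B i)"
    "c' - c \<in> diff_set (C i) (C i)"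
    using i j k eq unfolding diff_set_def by blast+
  moreover have "(a - a') + (b' - b) + (c' - c) = 0"
    using zero by (simp add: algebra_simps)
  moreover have "triple_product_property (A i) (B i) (C i)"
    using stpp i unfolding STPP_construction_def by blast
  ultimately have "a - a' = 0 \<and> b' - b = 0 \<and> c' - c = 0"
    unfolding triple_product_property_def by blast
  then show ?thesis using eq by simp
qed

text \<open>Any \<open>c\<close> in the nonempty set \<open>C i\<close> completes the equal
  differences to a zero sum \<open>(a' - b') + (b - c) + (c - a)\<close>, so
  \<open>STPP_zero_sum\<close> applies.\<close>

lemma STPP_diff_inj:
  assumes stpp: "STPP_construction I A B C"
    and i: "i \<in> I" "a \<in> A i" "b \<in> B i"
    and j: "j \<in> I" "a' \<in> A j" "b' \<in> B j"
    and eq: "a - b = a' - b'"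
  shows "i = j \<and> a = a' \<and> b = b'"
proof -
  obtain c where c: "c \<in> C i"
    using stpp i unfolding STPP_construction_def by blast
  have "(a' - b') + (b - c) + (c - a) = 0"
    using eq[symmetric] by simp
  from STPP_zero_sum[OF stpp j i(1,3) c i(1) c i(2) this] show ?thesis by simp
qed

text \<open>Weights must depend on the group element \<open>a - b\<close> alone. By
  \<open>STPP_diff_inj\<close> this element determines \<open>i\<close>, \<open>a\<close> and
  \<open>b\<close>, so any \<open>\<phi>\<close> factors through the difference.\<close>

lemma STPP_lift_to_diff:
  fixes A B C :: "'i \<Rightarrow> 'a::ab_group_add set"
  assumes "STPP_construction I A B C"
  obtains \<alpha> where "\<And>i a b. i \<in> I \<Longrightarrow> a \<in> A i \<Longrightarrow> b \<in> B i \<Longrightarrow> \<alpha> (a - b) = \<phi> i a b"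
proof -
  define X where "X = (SIGMA i:I. A i \<times> B i)"
  define F where "F = (\<lambda>(i::'i, a::'a, b). a - b)"
  have "inj_on F X"
    unfolding inj_on_def F_def X_def using STPP_diff_inj[OF assms] by fastforce
  then have "(case inv_into X F (a - b) of (i, a, b) \<Rightarrow> \<phi> i a b) = \<phi> i a b"
    if "i \<in> I" "a \<in> A i" "b \<in> B i" for i a b
    using inv_into_f_f[of F X "(i, a, b)"] that by (simp add: F_def X_def)
  then show ?thesis
    by (intro that[of "\<lambda>s. case inv_into X F s of (i, a, b) \<Rightarrow> \<phi> i a b"])
qed

lemma popular_sum:
  fixes f :: "'a \<Rightarrow> nat" and g :: "'b \<Rightarrow> nat" and h :: "'c \<Rightarrow> nat"
  assumes fin: "finite A" "finite B" "finite C" and ne: "A \<noteq> {}"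
    and f: "f ` A \<subseteq> {..<card A}" and g: "g ` B \<subseteq> {..<card B}" and h: "h ` C \<subseteq> {..<card C}"
  obtains k where "card A * card B * card C \<le>
    card {(a, b, c) \<in> A \<times> B \<times> C. f a + g b + h c = k} * (card A + card B + card C)"
proof -
  let ?F = "\<lambda>(a, b, c). f a + g b + h c" and ?K = "{..<card A + card B + card C}"
  \<comment> \<open>Each summand is strictly below its own cardinality, so the sum is strictly below
    the total. This crude count of the values gives the denominator of the final bound.\<close>
  have "f a + g b + h c < card A + card B + card C" if "a \<in> A" "b \<in> B" "c \<in> C" for a b c
    using f g h that by (intro add_strict_mono) auto
  then have "?F \<in> A \<times> B \<times> C \<rightarrow> ?K" by auto
  moreover have "?K \<noteq> {}" using fin ne by (simp add: lessThan_empty_iff)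
  ultimately obtain k where
    "card (A \<times> B \<times> C) \<le> card (?F -` {k} \<inter> A \<times> B \<times> C) * card ?K"
    using pigeonhole_card[of ?F "A \<times> B \<times> C" ?K] fin by auto
  moreover have "?F -` {k} \<inter> A \<times> B \<times> C = {(a, b, c) \<in> A \<times> B \<times> C. f a + g b + h c = k}"
    by auto
  ultimately show ?thesis by (intro that[of k]) (simp add: card_cartesian_product ac_simps)
qed

lemma finite_family_numbering:
  assumes "\<And>i. i \<in> I \<Longrightarrow> finite (A i)"
  obtains f :: "'i \<Rightarrow> 'a \<Rightarrow> nat"
  where "\<And>i. i \<in> I \<Longrightarrow> inj_on (f i) (A i)" "\<And>i. i \<in> I \<Longrightarrow> f i ` A i \<subseteq> {..<card (A i)}"
proof -
  have "\<forall>i\<in>I. \<exists>h. bij_betw h (A i) {0..<card (A i)}"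
    using assms ex_bij_betw_finite_nat by blast
  then obtain f where "\<forall>i\<in>I. bij_betw (f i) (A i) {0..<card (A i)}"
    by metis
  then show ?thesis by (intro that[of f]) (auto simp: bij_betw_def)
qed

theorem theorem3p3:
  fixes I :: "'i set" and A B C :: "'i \<Rightarrow> 'a::ab_group_add set"
  assumes "STPP_construction I A B C"
  shows "\<exists>(S :: 'a set) T U M \<alpha> \<beta> \<gamma>.
           border_tricolored_sum_free S T U M \<alpha> \<beta> \<gamma> \<and>
           real (card M) \<ge>
             (\<Sum>i\<in>I. real (card (A i) * card (B i) * card (C i)) /
                     real (card (A i) + card (B i) + card (C i)))"
proof -
  note stpp = assms
  note stpp' = STPP_rotate[OF stpp]
  note stpp'' = STPP_rotate[OF stpp']
  have finI: "finite I"
    using stpp unfolding STPP_construction_def by blast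
  have fin: "finite (A i)" "finite (B i)" "finite (C i)" and ne: "A i \<noteq> {}" if "i \<in> I" for i
    using stpp that unfolding STPP_construction_def by blast+
  obtain f where f: "\<And>i. i \<in> I \<Longrightarrow> inj_on (f i) (A i)"
    "\<And>i. i \<in> I \<Longrightarrow> f i ` A i \<subseteq> {..<card (A i)}"
    using finite_family_numbering[of I A, OF fin(1)] by blast
  obtain g where g: "\<And>i. i \<in> I \<Longrightarrow> inj_on (g i) (B i)"
    "\<And>i. i \<in> I \<Longrightarrow> g i ` B i \<subseteq> {..<card (B i)}"
    using finite_family_numbering[of I B, OF fin(2)] by blast
  obtain h where h: "\<And>i. i \<in> I \<Longrightarrow> inj_on (h i) (C i)"
    "\<And>i. i \<in> I \<Longrightarrow> h i ` C i \<subseteq> {..<card (C i)}"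
    using finite_family_numbering[of I C, OF fin(3)] by blast
  define P where "P i k = {(a, b, c) \<in> A i \<times> B i \<times> C i. f i a + g i b + h i c = k}" for i k
  have "\<exists>k. card (A i) * card (B i) * card (C i) \<le>
      card (P i k) * (card (A i) + card (B i) + card (C i))" if i: "i \<in> I" for i
    unfolding P_def
    by (rule popular_sum[OF fin[OF i] ne[OF i] f(2)[OF i] g(2)[OF i] h(2)[OF i]]) (rule exI)
  then obtain k where k: "\<And>i. i \<in> I \<Longrightarrow> card (A i) * card (B i) * card (C i) \<le>
      card (P i (k i)) * (card (A i) + card (B i) + card (C i))"
    by metis
  \<comment> \<open>Tagging the triples with their index makes \<open>card Q\<close> a sum over
    \<open>I\<close> without a separate disjointness argument.\<close>
  define Q where "Q = (SIGMA i:I. P i (k i))"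
  have Q_iff: "(i, a, b, c) \<in> Q \<longleftrightarrow>
      i \<in> I \<and> a \<in> A i \<and> b \<in> B i \<and> c \<in> C i \<and> f i a + g i b + h i c = k i" for i a b c
    unfolding Q_def P_def by auto
  define m where "m = (\<lambda>(i::'i, a::'a, b::'a, c::'a). (a - b, b - c, c - a))"
  define M where "M = m ` Q"
  have M_iff: "p \<in> M \<longleftrightarrow> (\<exists>i a b c. (i, a, b, c) \<in> Q \<and> p = (a - b, b - c, c - a))" for p
    unfolding M_def m_def by force
  \<comment> \<open>These facts serve twice: they give the three bijections of the perfect matching,
    and the first also gives \<open>card M = card Q\<close>.\<close>
  have inj: "inj_on (fst \<circ> m) Q" "inj_on (fst \<circ> snd \<circ> m) Q" "inj_on (snd \<circ> snd \<circ> m) Q"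
  proof -
    \<comment> \<open>One common difference fixes the index and two of the three elements. The
      equation with \<open>k i\<close> then fixes the number of the third, and the numbering is
      injective.\<close>
    have det: "x = y"
      if xy: "x = (i, a, b, c)" "y = (i', a', b', c')" "x \<in> Q" "y \<in> Q"
        and d: "a - b = a' - b' \<or> b - c = b' - c' \<or> c - a = c' - a'"
      for x y i a b c i' a' b' c'
    proof -
      have mem: "i \<in> I" "a \<in> A i" "b \<in> B i" "c \<in> C i" "f i a + g i b + h i c = k i"
        "i' \<in> I" "a' \<in> A i'" "b' \<in> B i'" "c' \<in> C i'" "f i' a' + g i' b' + h i' c' = k i'"
        using xy Q_iff by auto
      have "i = i' \<and> (a = a' \<and> b = b' \<or> b = b' \<and> c = c' \<or> c = c' \<and> a = a')"
        using d mem STPP_diff_inj[OF stpp, of i a b i' a' b']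
          STPP_diff_inj[OF stpp', of i b c i' b' c'] STPP_diff_inj[OF stpp'', of i c a i' c' a']
        by blast
      moreover have "f i a = f i a' \<Longrightarrow> a = a'" "g i b = g i b' \<Longrightarrow> b = b'"
        "h i c = h i c' \<Longrightarrow> c = c'"
        if "i = i'"
        using that mem inj_onD[OF f(1)] inj_onD[OF g(1)] inj_onD[OF h(1)] by blast+
      ultimately show ?thesis using mem xy by auto
    qed
    show "inj_on (fst \<circ> m) Q" "inj_on (fst \<circ> snd \<circ> m) Q" "inj_on (snd \<circ> snd \<circ> m) Q"
      by (auto intro!: inj_onI simp: m_def dest: det[OF refl refl])
  qed
  have "inj_on m Q" using inj(1) by (rule inj_on_imageI2)
  have card_M: "card M = (\<Sum>i\<in>I. card (P i (k i)))"
  proof -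
    have "finite (P i (k i))" if "i \<in> I" for i
      using fin[OF that] unfolding P_def
      by (intro finite_subset[OF _ finite_cartesian_product[of "A i" "B i \<times> C i"]]) auto
    then show ?thesis
      using card_image[OF \<open>inj_on m Q\<close>] finI unfolding M_def Q_def by simp
  qed
  define S where "S = fst ` M"
  define T where "T = (fst \<circ> snd) ` M"
  define U where "U = (snd \<circ> snd) ` M"
  have proj: "(\<lambda>(s, t, u). s) = fst" "(\<lambda>(s, t, u). t) = fst \<circ> snd" "(\<lambda>(s, t, u). u) = snd \<circ> snd"
    by auto
  have pm: "perfect_matching_3d S T U M"
    unfolding perfect_matching_3d_def proj
  proof (intro conjI)
    show "M \<subseteq> S \<times> T \<times> U" unfolding S_def T_def U_def by force
    show "bij_betw fst M S" "bij_betw (fst \<circ> snd) M T" "bij_betw (snd \<circ> snd) M U"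
      using inj unfolding S_def T_def U_def M_def
      by (auto simp: bij_betw_def intro: inj_on_imageI)
  qed
  \<comment> \<open>In the expansion of \<open>(x + y + z - k i)\<^sup>2\<close>, each cyclic pair
    receives the square and the linear term of its first variable together with the cross term. Only
    the constant \<open>(k i)\<^sup>2\<close> remains; it is assigned to
    \<open>\<alpha>\<close>.\<close>
  define w where "w i x y = (int x)\<^sup>2 + 2 * int x * int y - 2 * int (k i) * int x" for i x y
  obtain \<alpha> where \<alpha>: "\<And>i a b. i \<in> I \<Longrightarrow> a \<in> A i \<Longrightarrow> b \<in> B i \<Longrightarrow>
      \<alpha> (a - b) = w i (f i a) (g i b) + (int (k i))\<^sup>2"
    using STPP_lift_to_diff[OF stpp, of "\<lambda>i a b. w i (f i a) (g i b) + (int (k i))\<^sup>2"] by blast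
  obtain \<beta> where \<beta>: "\<And>i b c. i \<in> I \<Longrightarrow> b \<in> B i \<Longrightarrow> c \<in> C i \<Longrightarrow>
      \<beta> (b - c) = w i (g i b) (h i c)"
    using STPP_lift_to_diff[OF stpp', of "\<lambda>i b c. w i (g i b) (h i c)"] by blast
  obtain \<gamma> where \<gamma>: "\<And>i c a. i \<in> I \<Longrightarrow> c \<in> C i \<Longrightarrow> a \<in> A i \<Longrightarrow>
      \<gamma> (c - a) = w i (h i c) (f i a)"
    using STPP_lift_to_diff[OF stpp'', of "\<lambda>i c a. w i (h i c) (f i a)"] by blast
  have weight: "\<alpha> (a - b) + \<beta> (b - c) + \<gamma> (c - a) =
      (int (f i a) + int (g i b) + int (h i c) - int (k i))\<^sup>2"
    if "i \<in> I" "a \<in> A i" "b \<in> B i" "c \<in> C i" for i a b c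
    using that by (simp add: \<alpha> \<beta> \<gamma> w_def power2_eq_square algebra_simps)
  have on_M: "s + t + u = 0 \<and> \<alpha> s + \<beta> t + \<gamma> u = 0" if stu: "(s, t, u) \<in> M" for s t u
  proof -
    obtain i a b c where q: "(i, a, b, c) \<in> Q" "s = a - b" "t = b - c" "u = c - a"
      using stu M_iff by auto
    moreover have "int (f i a) + int (g i b) + int (h i c) - int (k i) = 0"
      using q Q_iff by (metis diff_self of_nat_add)
    ultimately show ?thesis using weight[of i a b c] Q_iff by simp
  qed
  have off_M: "\<alpha> s + \<beta> t + \<gamma> u > 0"
    if stu: "s \<in> S" "t \<in> T" "u \<in> U" "(s, t, u) \<notin> M" and zero: "s + t + u = 0" for s t u
  proof -
    obtain i a b where s: "i \<in> I" "a \<in> A i" "b \<in> B i" "s = a - b"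
      using stu(1) unfolding S_def by (auto simp: M_iff Q_iff)
    obtain j b' c where t: "j \<in> I" "b' \<in> B j" "c \<in> C j" "t = b' - c"
      using stu(2) unfolding T_def by (auto simp: M_iff Q_iff)
    obtain l c' a' where u: "l \<in> I" "c' \<in> C l" "a' \<in> A l" "u = c' - a'"
      using stu(3) unfolding U_def by (auto simp: M_iff Q_iff)
    \<comment> \<open>The zero sum forces the form \<open>(a - b, b - c, c - a)\<close> with a
      single index. Such a triple can miss \<open>M\<close> only by failing the equation with
      \<open>k i\<close>, and then its weight is the square of a nonzero integer.\<close>
    have eq: "i = j" "j = l" "a = a'" "b = b'" "c = c'"
      using STPP_zero_sum[OF stpp s(1-3) t(1-3) u(1-3)] zero s(4) t(4) u(4) by auto
    then have "(i, a, b, c) \<notin> Q"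
      using stu(4) s(4) t(4) u(4) M_iff by blast
    then have "f i a + g i b + h i c \<noteq> k i"
      using s t u eq Q_iff by blast
    then have "int (f i a) + int (g i b) + int (h i c) - int (k i) \<noteq> 0"
      by linarith
    then show ?thesis using weight[of i a b c] s t u eq by simp
  qed
  have "border_tricolored_sum_free S T U M \<alpha> \<beta> \<gamma>"
    unfolding border_tricolored_sum_free_def using pm on_M off_M by blast
  moreover have "(\<Sum>i\<in>I. real (card (A i) * card (B i) * card (C i)) /
      real (card (A i) + card (B i) + card (C i))) \<le> real (card M)"
    unfolding card_M of_nat_sum
  proof (rule sum_mono)
    fix i assume i: "i \<in> I"
    have "card (A i) > 0" using fin ne i by (simp add: card_gt_0_iff)
    then have "real (card (A i) + card (B i) + card (C i)) > 0" by simp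
    moreover have "real (card (A i) * card (B i) * card (C i)) \<le>
        real (card (P i (k i))) * real (card (A i) + card (B i) + card (C i))"
      using k[OF i] by (metis of_nat_le_iff of_nat_mult)
    ultimately show "real (card (A i) * card (B i) * card (C i)) /
        real (card (A i) + card (B i) + card (C i)) \<le> real (card (P i (k i)))"
      by (simp only: pos_divide_le_eq)
  qed
  ultimately show ?thesis by blast
qed

end
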